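(* Let $(L,\mathcal G)$ be a nestoid. For a cone $C$ of the universe fan $\mathcal U_{\mathcal G}$ put $$\beta^+(C):=\{g\in\mathcal G\mid \exists x\in C:\ p_g(x)\ne0\},\qquad \beta^-(C):=\{g\in\mathcal G\mid \exists x\in C:\ m_g(x)\neq0\},$$ $$N(C):=\beta^+(C)\cup\beta^-(C),\qquad \beta^\bullet(C):=\{g\in N(C)\setminus\{\hat 1\}\mid \exists x\in C:\ F_g(x)\ne0\}.$$ Then $C\mapsto (N(C),\beta^+(C),\beta^-(C),\beta^\bullet(C))$ is a bijection from the set of cones of $\mathcal U_{\mathcal G}$ to the set of marked nested sets of $(L,\mathcal G)$.
   Context: All lattices are finite. Let $L$ be a lattice with minimum $\hat 0$ and maximum $\hat 1$. A subset $\mathcal G\subseteq L_{>\hat 0}$ is nestable if $\hat 1\in\mathcal G$ and for any two incomparable $f,g\in\mathcal G$, $f\vee g\notin\mathcal G$ implies $f\wedge g=\hat 0$. A subset $N\subseteq\mathcal G$ is nested if for all $k\ge 2$ and pairwise incomparable $f_1,\dots,f_k\in N$ one has $f_1\vee\dots\vee f_k\notin\mathcal G$. $\mathcal N(L,\mathcal G)$ is the simplicial complex of nested sets. $(L,\mathcal G)$ is a nestoid if $\mathcal G$ is nestable and for every $f\in\mathcal G$ the complex $\mathcal N([\hat 0,f],\mathcal G\cap[\hat 0,f])$ is pure. $\mathbb R^{2\mathcal G}$ is the real vector space with basis $f^+,f^-$ ($f\in\mathcal G$); $p_f,m_f$ are the dual coordinates. For a nested set $N$, $\mathbb R_+^{2N}$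 is the cone spanned by $f^+,f^-$, $f\in N$. The fan $\Sigma^{2\mathcal G}$ consists of all faces of the cones $\mathbb R_+^{2N}$, $N\in\mathcal N(L,\mathcal G)$. For $g\in\mathcal G$ put $F_g:=p_{\hat 1}+\sum_{f\in\mathcal G,\ g<f<\hat 1}(p_f-m_f)-m_g$. The causal cone is $\{m_{\hat 1}=0,\ p_g\ge0,\ m_g\ge0,\ F_g\ge 0\ \forall g\in\mathcal G\}\subseteq\mathbb R^{2\mathcal G}$. The universe fan $\mathcal U_{\mathcal G}$ is obtained by intersecting the cones of $\Sigma^{2\mathcal G}$ with the causal cone (its cones are these intersections and all their faces). A marked nested set is a nested set $N$ (possibly empty) with a marking, i.e. a triple $(\beta_N^+,\beta_N^-,\beta_N^\bullet)$ of subsets of $N$ such that (with coverings taken in the poset $N$): (1) $N=\beta_N^+\cup\beta_N^-$; (2) $\max N\subseteq \beta_N^+\setminus(\beta_N^-\cup\beta_N^\bullet)$, where $\max N$ is the set of maximal elements of $N$; (3) if $f\in\beta_N^+$ covers $g$ then $g\in\beta_N^-\cup\beta_N^\bullet$; (4) if $g\in\beta_N^-$ is covered by $f$ then $f\in\beta_N^+\cup\beta_N^\bullet$; (5) if $g\in\beta_N^\bullet$, then $f\in\beta_N^+\cup\beta_N^\bullet$ for $f$ covering $g$, and $h\in\beta_N^-\cup\beta_N^\bullet$ for every $h$ covered by $g$. *)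

theory Defs
  imports "HOL-Analysis.Analysis"
begin

definition incomparable :: "'a::order \<Rightarrow> 'a \<Rightarrow> bool" where
  "incomparable f g \<longleftrightarrow> \<not> f \<le> g \<and> \<not> g \<le> f"

text \<open>
  The finite lattice is the whole type, and a finite nonempty lattice is bounded, hence the
  sort \<open>{finite, bounded_lattice}\<close> throughout.
\<close>

definition nestable :: "'a::{finite, bounded_lattice} set \<Rightarrow> bool" where
  "nestable G \<longleftrightarrow>
     G \<subseteq> {bot<..} \<and> top \<in> G \<and>
     (\<forall>f\<in>G. \<forall>g\<in>G. incomparable f g \<longrightarrow> sup f g \<notin> G \<longrightarrow> inf f g = bot)"

text \<open>
  A family \<open>f\<^sub>1, \<dots>, f\<^sub>k\<close> of pairwise incomparable elements has distinct members, so it is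
  represented by the set \<open>A\<close> of its members.
\<close>

definition nested :: "'a::{finite, bounded_lattice} set \<Rightarrow> 'a set \<Rightarrow> bool" where
  "nested G N \<longleftrightarrow>
     N \<subseteq> G \<and>
     (\<forall>A\<subseteq>N. card A \<ge> 2 \<longrightarrow> pairwise incomparable A \<longrightarrow> Sup_fin A \<notin> G)"

definition nested_complex :: "'a::{finite, bounded_lattice} set \<Rightarrow> 'a set set" where
  "nested_complex G = {N. nested G N}"

definition pure_complex :: "'a set set \<Rightarrow> bool" where
  "pure_complex K \<longleftrightarrow>
     (\<forall>S\<in>K. \<forall>T\<in>K. (\<forall>U\<in>K. \<not> S \<subset> U) \<longrightarrow> (\<forall>U\<in>K. \<not> T \<subset> U) \<longrightarrow> card S = card T)"

text \<open>
  Joins in the interval \<open>{bot..f}\<close> agree with those of the ambient lattice, so the nested set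
  complex of the interval is \<^term>\<open>nested_complex (G \<inter> {bot..f})\<close>.
\<close>

definition nestoid :: "'a::{finite, bounded_lattice} set \<Rightarrow> bool" where
  "nestoid G \<longleftrightarrow>
     nestable G \<and> (\<forall>f\<in>G. pure_complex (nested_complex (G \<inter> {bot..f})))"

text \<open>
  The space with basis \<open>f\<^sup>+, f\<^sup>-\<close> (\<open>f \<in> G\<close>) is the subspace \<open>double_space G\<close> of the
  following type: the first component holds the coordinates \<open>p\<^sub>f\<close>, the second the
  coordinates \<open>m\<^sub>f\<close>.
\<close>

type_synonym 'a double = "(real ^ 'a) \<times> (real ^ 'a)"

definition plus_basis :: "'a::finite \<Rightarrow> 'a double" where
  "plus_basis f = (axis f 1, 0)"

definition minus_basis :: "'a::finite \<Rightarrow> 'a double" where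
  "minus_basis f = (0, axis f 1)"

definition p_coord :: "'a::finite \<Rightarrow> 'a double \<Rightarrow> real" where
  "p_coord f x = fst x $ f"

definition m_coord :: "'a::finite \<Rightarrow> 'a double \<Rightarrow> real" where
  "m_coord f x = snd x $ f"

definition double_space :: "'a::finite set \<Rightarrow> 'a double set" where
  "double_space G = span (plus_basis ` G \<union> minus_basis ` G)"

definition double_cone :: "'a::finite set \<Rightarrow> 'a double set" where
  "double_cone N = convex_cone hull (plus_basis ` N \<union> minus_basis ` N)"

text \<open>
  Unlike for cones, the empty set counts as a face for \<^const>\<open>face_of\<close>; it is excluded from
  the fans.
\<close>

definition double_fan :: "'a::{finite, bounded_lattice} set \<Rightarrow> 'a double set set" where
  "double_fan G = {C. C \<noteq> {} \<and> (\<exists>N\<in>nested_complex G. C face_of double_cone N)}"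

definition flow :: "'a::{finite, bounded_lattice} set \<Rightarrow> 'a \<Rightarrow> 'a double \<Rightarrow> real" where
  "flow G g x =
     p_coord top x + (\<Sum>f\<in>{f\<in>G. g < f \<and> f < top}. p_coord f x - m_coord f x) - m_coord g x"

definition causal_cone :: "'a::{finite, bounded_lattice} set \<Rightarrow> 'a double set" where
  "causal_cone G =
     {x \<in> double_space G. m_coord top x = 0 \<and>
        (\<forall>g\<in>G. p_coord g x \<ge> 0 \<and> m_coord g x \<ge> 0 \<and> flow G g x \<ge> 0)}"

text \<open>
  Each intersection is a face of itself, so the intersections themselves are included.
\<close>

definition universe_fan :: "'a::{finite, bounded_lattice} set \<Rightarrow> 'a double set set" where
  "universe_fan G =
     {C. C \<noteq> {} \<and> (\<exists>S\<in>double_fan G. C face_of (S \<inter> causal_cone G))}"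

definition max_elems :: "'a::order set \<Rightarrow> 'a set" where
  "max_elems N = {f\<in>N. \<not> (\<exists>g\<in>N. f < g)}"

definition covers_in :: "'a::order set \<Rightarrow> 'a \<Rightarrow> 'a \<Rightarrow> bool" where
  "covers_in N f g \<longleftrightarrow> f \<in> N \<and> g \<in> N \<and> g < f \<and> \<not> (\<exists>h\<in>N. g < h \<and> h < f)"

definition marking :: "'a::order set \<Rightarrow> 'a set \<Rightarrow> 'a set \<Rightarrow> 'a set \<Rightarrow> bool" where
  "marking N P M B \<longleftrightarrow>
     P \<subseteq> N \<and> M \<subseteq> N \<and> B \<subseteq> N \<and>
     N = P \<union> M \<and>
     max_elems N \<subseteq> P - (M \<union> B) \<and>
     (\<forall>f g. f \<in> P \<longrightarrow> covers_in N f g \<longrightarrow> g \<in> M \<union> B) \<and>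
     (\<forall>f g. g \<in> M \<longrightarrow> covers_in N f g \<longrightarrow> f \<in> P \<union> B) \<and>
     (\<forall>g\<in>B. (\<forall>f. covers_in N f g \<longrightarrow> f \<in> P \<union> B) \<and>
             (\<forall>h. covers_in N g h \<longrightarrow> h \<in> M \<union> B))"

definition marked_nested_sets ::
  "'a::{finite, bounded_lattice} set \<Rightarrow> ('a set \<times> 'a set \<times> 'a set \<times> 'a set) set" where
  "marked_nested_sets G = {(N, P, M, B). N \<in> nested_complex G \<and> marking N P M B}"

definition beta_plus :: "'a::finite set \<Rightarrow> 'a double set \<Rightarrow> 'a set" where
  "beta_plus G C = {g\<in>G. \<exists>x\<in>C. p_coord g x \<noteq> 0}"

definition beta_minus :: "'a::finite set \<Rightarrow> 'a double set \<Rightarrow> 'a set" where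
  "beta_minus G C = {g\<in>G. \<exists>x\<in>C. m_coord g x \<noteq> 0}"

definition cone_support :: "'a::finite set \<Rightarrow> 'a double set \<Rightarrow> 'a set" where
  "cone_support G C = beta_plus G C \<union> beta_minus G C"

definition beta_bullet :: "'a::{finite, bounded_lattice} set \<Rightarrow> 'a double set \<Rightarrow> 'a set" where
  "beta_bullet G C = {g \<in> cone_support G C - {top}. \<exists>x\<in>C. flow G g x \<noteq> 0}"

end

theory Submission
  imports Defs
begin

text \<open>
  A cone of the universe fan is a face of some \<^term>\<open>double_cone N \<inter> causal_cone G\<close> with \<open>N\<close>
  nested, and this intersection is cut out of a linear subspace by the inequalities \<open>p\<^sub>g \<ge> 0\<close>,
  \<open>m\<^sub>g \<ge> 0\<close>, \<open>F\<^sub>g \<ge> 0\<close>. Its nonempty faces are therefore given by the zero patterns of its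
  points: each is the set of points at which all functionals vanish that vanish at a chosen
  relative interior point \<open>x\<close> (\<open>nonempty_faces_of_inequality_system\<close>). That set depends on \<open>x\<close>
  only, as the support of its points lies in that of \<open>x\<close>. So the cones of the universe fan are
  the strata of causal points with nested support (\<open>universe_fan_eq_strata\<close>), and the data
  \<open>(N, \<beta>\<^sup>+, \<beta>\<^sup>-, \<beta>\<^sup>\<bullet>)\<close> of a cone can be read off from any point \<open>x\<close> defining it.

  The combinatorics comes from a conservation law. A nested set is a forest: the elements above a
  given member of \<open>G\<close> form a chain. Hence, if \<open>h\<close> is the least element of \<open>N\<close> above \<open>g\<close>, then
  comparing the sums that define \<open>F\<^sub>g\<close> and \<open>F\<^sub>h\<close> gives \<open>F\<^sub>g + m\<^sub>g = F\<^sub>h + p\<^sub>h\<close>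
  (\<open>transit_conservation\<close>): what passes \<open>h\<close> or starts there either stops at \<open>g\<close> or passes it. At the
  maximum, where \<open>F = p - m\<close>, the passing amount is taken to be \<open>0\<close> instead of \<open>F\<close>. All four
  terms are nonnegative on the causal cone, so one side vanishes exactly when the other does. For a
  covering \<open>h > g\<close> in \<open>N\<close> this says \<open>h \<in> \<beta>\<^sup>+ \<union> \<beta>\<^sup>\<bullet> \<longleftrightarrow> g \<in> \<beta>\<^sup>- \<union> \<beta>\<^sup>\<bullet>\<close>, which is what the
  covering conditions on a marking amount to (\<open>marking_iff\<close>); at a maximal element of \<open>N\<close> nothing
  comes in, so nothing stops there and nothing passes. Thus every cone yields a marked nested set.

  For injectivity, the zero pattern also involves \<open>F\<^sub>g\<close> with \<open>g\<close> outside \<open>N\<close> and with \<open>g\<close> the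
  maximum; by the conservation law and by \<open>F = p - m\<close> at the maximum, these are governed by the marking
  (\<open>causal_stratum_determined_by_betas\<close>). For surjectivity, a flow with prescribed zero pattern is
  built downwards along the forest: at each new element \<open>g\<close> the incoming amount is positive
  exactly when \<open>g \<in> M \<union> B\<close>, and it can then be divided between stopping and passing as
  the marking demands (\<open>marking_realisable\<close>).
\<close>

section \<open>Faces of a homogeneous system of linear inequalities\<close>

text \<open>
  A point in the relative interior of a face satisfies with equality exactly those inequalities
  that hold with equality on the whole face; conversely, a point of the cone whose tight
  inequalities include those of \<open>x\<close> can be reflected through \<open>x\<close>, by a small amount, without
  leaving the cone, so that any face containing \<open>x\<close> contains it.
\<close>

lemma nonempty_faces_of_inequality_system:
  fixes V :: "'e::euclidean_space set" and \<Lambda> :: "('e \<Rightarrow> real) set"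
  assumes V: "subspace V" and fin: "finite \<Lambda>" and lin: "\<And>l. l \<in> \<Lambda> \<Longrightarrow> linear l"
    and K: "K = {x \<in> V. \<forall>l\<in>\<Lambda>. 0 \<le> l x}"
  shows "C face_of K \<and> C \<noteq> {} \<longleftrightarrow> (\<exists>x\<in>K. C = {y \<in> K. \<forall>l\<in>\<Lambda>. l x = 0 \<longrightarrow> l y = 0})"
proof
  assume "C face_of K \<and> C \<noteq> {}"
  then have face: "C face_of K" and ne: "C \<noteq> {}" by auto
  have conv: "convex C" and CK: "C \<subseteq> K"
    using face by (auto simp: face_of_imp_convex face_of_imp_subset)
  obtain x where x: "x \<in> rel_interior C"
    using rel_interior_eq_empty[OF conv] ne by blast
  then have xC: "x \<in> C" using rel_interior_subset by blast
  have "C = {y \<in> K. \<forall>l\<in>\<Lambda>. l x = 0 \<longrightarrow> l y = 0}"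
  proof (intro equalityI subsetI)
    fix y assume yC: "y \<in> C"
    have "l y = 0" if l: "l \<in> \<Lambda>" and lx: "l x = 0" for l
    proof -
      obtain e where e: "e > 1" "(1 - e) *\<^sub>R y + e *\<^sub>R x \<in> C"
        using x yC convex_rel_interior_iff[OF conv ne] by blast
      then have "0 \<le> l ((1 - e) *\<^sub>R y + e *\<^sub>R x)" using CK K l by blast
      then have "0 \<le> (1 - e) * l y"
        using lx by (simp add: linear_add[OF lin[OF l]] linear_scale[OF lin[OF l]])
      then have "l y \<le> 0" using e(1) by (simp add: zero_le_mult_iff)
      moreover have "0 \<le> l y" using yC CK K l by blast
      ultimately show ?thesis by simp
    qed
    then show "y \<in> {y \<in> K. \<forall>l\<in>\<Lambda>. l x = 0 \<longrightarrow> l y = 0}" using yC CK by blast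
  next
    fix y assume "y \<in> {y \<in> K. \<forall>l\<in>\<Lambda>. l x = 0 \<longrightarrow> l y = 0}"
    then have yK: "y \<in> K" and zero: "\<And>l. l \<in> \<Lambda> \<Longrightarrow> l x = 0 \<Longrightarrow> l y = 0" by auto
    have xK: "x \<in> K" using xC CK by blast
    have "\<forall>l\<in>\<Lambda>. eventually (\<lambda>e. 0 \<le> l x + e * (l x - l y)) (at_right 0)"
    proof
      fix l assume l: "l \<in> \<Lambda>"
      show "eventually (\<lambda>e. 0 \<le> l x + e * (l x - l y)) (at_right 0)"
      proof (cases "l x = 0")
        case True
        then show ?thesis using zero[OF l] by simp
      next
        case False
        then have pos: "0 < l x" using xK K l by (simp add: order_less_le)
        have "((\<lambda>e. l x + e * (l x - l y)) \<longlongrightarrow> l x + 0 * (l x - l y)) (at_right 0)"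
          by (intro tendsto_intros)
        then have "((\<lambda>e. l x + e * (l x - l y)) \<longlongrightarrow> l x) (at_right 0)" by simp
        from order_tendstoD(1)[OF this pos] show ?thesis
          by eventually_elim simp
      qed
    qed
    then have "eventually (\<lambda>e. \<forall>l\<in>\<Lambda>. 0 \<le> l x + e * (l x - l y)) (at_right 0)"
      using fin by (simp add: eventually_ball_finite)
    moreover have "eventually (\<lambda>e::real. 0 < e) (at_right 0)"
      by (simp add: eventually_at_right_less)
    ultimately obtain e :: real where e: "0 < e" "\<forall>l\<in>\<Lambda>. 0 \<le> l x + e * (l x - l y)"
      using eventually_happens'[OF trivial_limit_at_right_real[of 0] eventually_conj] by blast
    define z where "z = x + e *\<^sub>R (x - y)"
    have "z \<in> V" unfolding z_def using xK yK K V
      by (auto intro!: subspace_add subspace_scale subspace_diff)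
    moreover have "0 \<le> l z" if l: "l \<in> \<Lambda>" for l
      using e(2) l unfolding z_def
      by (simp add: linear_add[OF lin[OF l]] linear_scale[OF lin[OF l]] linear_diff[OF lin[OF l]])
    ultimately have zK: "z \<in> K" using K by blast
    show "y \<in> C"
    proof (cases "y = x")
      case True
      then show ?thesis using xC by simp
    next
      case False
      \<comment> \<open>As \<open>z = x + e (x - y)\<close>, the point \<open>x\<close> divides the segment from \<open>y\<close> to \<open>z\<close> in the ratio \<open>1 : e\<close>.\<close>
      have xz: "x = (1 - 1 / (1 + e)) *\<^sub>R y + (1 / (1 + e)) *\<^sub>R z"
      proof -
        have "(1 + e) *\<^sub>R ((1 - 1 / (1 + e)) *\<^sub>R y + (1 / (1 + e)) *\<^sub>R z) = e *\<^sub>R y + z"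
          using e(1) by (simp add: scaleR_add_right right_diff_distrib)
        also have "\<dots> = (1 + e) *\<^sub>R x"
          unfolding z_def by (simp add: algebra_simps)
        finally show ?thesis using e(1) by (metis add_pos_pos less_irrefl scaleR_cancel_left zero_less_one)
      qed
      have "y \<noteq> z"
      proof
        assume "y = z"
        then have "x = y" using xz by (metis diff_add_cancel scaleR_left.add scaleR_one)
        then show False using False by simp
      qed
      then have "x \<in> open_segment y z"
        unfolding in_segment using xz e(1) by (intro conjI exI[of _ "1 / (1 + e)"]) auto
      then show ?thesis using face xC yK zK unfolding face_of_def by blast
    qed
  qed
  then show "\<exists>x\<in>K. C = {y \<in> K. \<forall>l\<in>\<Lambda>. l x = 0 \<longrightarrow> l y = 0}" using xC CK by blast
next
  assume "\<exists>x\<in>K. C = {y \<in> K. \<forall>l\<in>\<Lambda>. l x = 0 \<longrightarrow> l y = 0}"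
  then obtain x where xK: "x \<in> K" and C: "C = {y \<in> K. \<forall>l\<in>\<Lambda>. l x = 0 \<longrightarrow> l y = 0}" by blast
  have "convex C"
  proof (rule convexI)
    fix a b and u v :: real
    assume ab: "a \<in> C" "b \<in> C" and uv: "0 \<le> u" "0 \<le> v"
    then show "u *\<^sub>R a + v *\<^sub>R b \<in> C"
      unfolding C K using V
      by (auto intro!: subspace_add subspace_scale simp: linear_add[OF lin] linear_scale[OF lin])
  qed
  moreover have "a \<in> C \<and> b \<in> C"
    if a: "a \<in> K" and b: "b \<in> K" and c: "c \<in> C" and seg: "c \<in> open_segment a b" for a b c
  proof -
    obtain u where u: "0 < u" "u < 1" "c = (1 - u) *\<^sub>R a + u *\<^sub>R b"
      using seg by (auto simp: in_segment)
    have "l a = 0 \<and> l b = 0" if l: "l \<in> \<Lambda>" and lx: "l x = 0" for l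
    proof -
      have "(1 - u) * l a + u * l b = 0"
        using c l lx u(3) unfolding C by (auto simp: linear_add[OF lin] linear_scale[OF lin])
      moreover have "0 \<le> (1 - u) * l a" "0 \<le> u * l b" using a b l u K by auto
      ultimately have "(1 - u) * l a = 0" "u * l b = 0" by linarith+
      then show ?thesis using u by simp
    qed
    then show ?thesis using a b unfolding C by blast
  qed
  ultimately have "C face_of K" unfolding face_of_def C by blast
  moreover have "x \<in> C" using xK C by blast
  ultimately show "C face_of K \<and> C \<noteq> {}" by blast
qed

section \<open>Coordinates on the doubled space\<close>

lemma linear_p_coord: "linear (p_coord g)"
  by (rule linearI) (simp_all add: p_coord_def)

lemma linear_m_coord: "linear (m_coord g)"
  by (rule linearI) (simp_all add: m_coord_def)

lemma linear_flow: "linear (flow G g)"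
  unfolding flow_def
  by (intro linear_compose_sub linear_compose_add linear_compose_sum ballI
      linear_p_coord linear_m_coord)

lemma coord_basis [simp]:
  "p_coord f (plus_basis g) = (if f = g then 1 else 0)"
  "m_coord f (plus_basis g) = 0"
  "p_coord f (minus_basis g) = 0"
  "m_coord f (minus_basis g) = (if f = g then 1 else 0)"
  by (simp_all add: p_coord_def m_coord_def plus_basis_def minus_basis_def axis_def)

lemma double_basis_expansion:
  "x = (\<Sum>f\<in>UNIV. p_coord f x *\<^sub>R plus_basis f + m_coord f x *\<^sub>R minus_basis f)"
proof -
  have "(\<Sum>f\<in>UNIV. p_coord f x *\<^sub>R plus_basis f + m_coord f x *\<^sub>R minus_basis f) =
        (\<Sum>f\<in>UNIV. (fst x $ f *\<^sub>R axis f 1, snd x $ f *\<^sub>R axis f 1))"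
    by (simp add: p_coord_def m_coord_def plus_basis_def minus_basis_def)
  also have "\<dots> = (fst x, snd x)"
    by (simp add: sum_prod basis_expansion[where 'a=real, unfolded scalar_mult_eq_scaleR])
  finally show ?thesis by simp
qed

lemma double_space_eq:
  "double_space N = {x. \<forall>f. f \<notin> N \<longrightarrow> p_coord f x = 0 \<and> m_coord f x = 0}" (is "_ = ?R")
proof
  have "subspace ?R"
    by (auto simp: subspace_def p_coord_def m_coord_def)
  moreover have "plus_basis ` N \<union> minus_basis ` N \<subseteq> ?R" by auto
  ultimately show "double_space N \<subseteq> ?R" unfolding double_space_def by (rule span_minimal[rotated])
next
  show "?R \<subseteq> double_space N"
  proof
    fix x assume "x \<in> ?R"
    then have "p_coord f x *\<^sub>R plus_basis f + m_coord f x *\<^sub>R minus_basis f \<in> double_space N" for f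
      unfolding double_space_def
      by (cases "f \<in> N") (auto intro!: span_add span_scale intro: span_base simp: span_zero)
    then show "x \<in> double_space N"
      unfolding double_space_def by (subst double_basis_expansion) (rule span_sum)
  qed
qed

lemma double_cone_eq:
  "double_cone N = {x \<in> double_space N. \<forall>f. 0 \<le> p_coord f x \<and> 0 \<le> m_coord f x}" (is "_ = ?R")
proof
  have "convex_cone ?R"
    unfolding convex_cone_iff double_space_eq by (auto simp: p_coord_def m_coord_def)
  moreover have "plus_basis ` N \<union> minus_basis ` N \<subseteq> ?R" by (auto simp: double_space_eq)
  ultimately show "double_cone N \<subseteq> ?R" unfolding double_cone_def by (rule hull_minimal[rotated])
next
  have gen: "y \<in> double_cone N" if "y \<in> plus_basis ` N \<union> minus_basis ` N" for y
    using that unfolding double_cone_def by (rule hull_inc)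
  have zero: "0 \<in> double_cone N"
    unfolding double_cone_def by (rule convex_cone_hull_contains_0)
  have add: "y + z \<in> double_cone N" if "y \<in> double_cone N" "z \<in> double_cone N" for y z
    using that unfolding double_cone_def by (rule convex_cone_hull_add)
  have scale: "c *\<^sub>R y \<in> double_cone N" if "y \<in> double_cone N" "0 \<le> c" for c y
    using that unfolding double_cone_def by (rule convex_cone_hull_mul)
  show "?R \<subseteq> double_cone N"
  proof
    fix x assume "x \<in> ?R"
    then have summand: "p_coord f x *\<^sub>R plus_basis f + m_coord f x *\<^sub>R minus_basis f \<in> double_cone N" for f
      by (cases "f \<in> N") (auto intro!: add scale intro: gen simp: double_space_eq zero)
    have "(\<Sum>f\<in>A. p_coord f x *\<^sub>R plus_basis f + m_coord f x *\<^sub>R minus_basis f) \<in> double_cone N"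
      if "finite A" for A
      using that by (induction A rule: finite_induct) (auto intro: add zero summand)
    from this[of UNIV] show "x \<in> double_cone N"
      by (simp flip: double_basis_expansion)
  qed
qed

section \<open>Cones of the universe fan as strata of points\<close>

definition causal_functionals :: "'a::{finite, bounded_lattice} set \<Rightarrow> ('a double \<Rightarrow> real) set" where
  "causal_functionals G = p_coord ` G \<union> m_coord ` G \<union> flow G ` G"

text \<open>
  No nested set enters apart from what \<open>x\<close> itself determines, so strata coming from different
  maximal cones of the fan can be compared directly.
\<close>

definition causal_stratum :: "'a::{finite, bounded_lattice} set \<Rightarrow> 'a double \<Rightarrow> 'a double set" where
  "causal_stratum G x =
     {y \<in> causal_cone G. \<forall>l\<in>causal_functionals G. l x = 0 \<longrightarrow> l y = 0}"

lemma linear_causal_functional: "l \<in> causal_functionals G \<Longrightarrow> linear l"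
  by (auto simp: causal_functionals_def linear_p_coord linear_m_coord linear_flow)

lemma mem_causal_stratum_iff:
  "y \<in> causal_stratum G x \<longleftrightarrow> y \<in> causal_cone G \<and>
     (\<forall>g\<in>G. (p_coord g x = 0 \<longrightarrow> p_coord g y = 0) \<and> (m_coord g x = 0 \<longrightarrow> m_coord g y = 0) \<and>
             (flow G g x = 0 \<longrightarrow> flow G g y = 0))"
  unfolding causal_stratum_def causal_functionals_def by blast

text \<open>
  The functionals indexed by \<open>G\<close> suffice, as the coordinates outside \<open>N \<subseteq> G\<close> vanish on
  \<^term>\<open>double_space N\<close>; this presents the intersection as a homogeneous system of inequalities in
  a subspace.
\<close>

lemma nested_cone_Int_causal_cone:
  assumes "N \<subseteq> G"
  shows "double_cone N \<inter> causal_cone G =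
    {x \<in> {x \<in> double_space N. m_coord top x = 0}. \<forall>l\<in>causal_functionals G. 0 \<le> l x}"
proof (intro equalityI subsetI)
  fix x assume "x \<in> double_cone N \<inter> causal_cone G"
  then show "x \<in> {x \<in> {x \<in> double_space N. m_coord top x = 0}. \<forall>l\<in>causal_functionals G. 0 \<le> l x}"
    unfolding double_cone_eq causal_cone_def causal_functionals_def by blast
next
  fix x assume x: "x \<in> {x \<in> {x \<in> double_space N. m_coord top x = 0}. \<forall>l\<in>causal_functionals G. 0 \<le> l x}"
  then have nonneg: "0 \<le> p_coord f x \<and> 0 \<le> m_coord f x \<and> 0 \<le> flow G f x" if "f \<in> G" for f
    using that unfolding causal_functionals_def by blast
  moreover have "p_coord f x = 0 \<and> m_coord f x = 0" if "f \<notin> N" for f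
    using x that unfolding double_space_eq by blast
  ultimately have "0 \<le> p_coord f x \<and> 0 \<le> m_coord f x" for f
    using assms by (cases "f \<in> N") auto
  moreover have "x \<in> double_space G"
    using x assms unfolding double_space_eq by blast
  ultimately show "x \<in> double_cone N \<inter> causal_cone G"
    using x nonneg unfolding double_cone_eq causal_cone_def by blast
qed

lemma subspace_double_space_m_top: "subspace {x \<in> double_space N. m_coord top x = 0}"
  unfolding double_space_eq subspace_def by (auto simp: p_coord_def m_coord_def)

lemma convex_causal_cone: "convex (causal_cone G)"
proof (rule convexI)
  fix x y :: "'a double" and u v :: real
  assume "x \<in> causal_cone G" "y \<in> causal_cone G" "0 \<le> u" "0 \<le> v"
  then show "u *\<^sub>R x + v *\<^sub>R y \<in> causal_cone G"
    unfolding causal_cone_def double_space_eq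
    by (auto simp: linear_add[OF linear_p_coord] linear_scale[OF linear_p_coord]
        linear_add[OF linear_m_coord] linear_scale[OF linear_m_coord]
        linear_add[OF linear_flow] linear_scale[OF linear_flow])
qed

lemma nested_subset: "nested G N \<Longrightarrow> M \<subseteq> N \<Longrightarrow> nested G M"
  unfolding nested_def by blast

lemma cone_support_subset: "cone_support G C \<subseteq> G"
  unfolding cone_support_def beta_plus_def beta_minus_def by blast

lemma not_mem_cone_support_point:
  "g \<in> G \<Longrightarrow> g \<notin> cone_support G {x} \<longleftrightarrow> p_coord g x = 0 \<and> m_coord g x = 0"
  unfolding cone_support_def beta_plus_def beta_minus_def by auto

lemma causal_point_mem_double_cone_iff:
  assumes "x \<in> causal_cone G" and "N \<subseteq> G"
  shows "x \<in> double_cone N \<longleftrightarrow> cone_support G {x} \<subseteq> N"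
proof -
  have "0 \<le> p_coord f x \<and> 0 \<le> m_coord f x" for f
    using assms(1) unfolding causal_cone_def double_space_eq by (cases "f \<in> G") auto
  then have "x \<in> double_cone N \<longleftrightarrow> (\<forall>f. f \<notin> N \<longrightarrow> p_coord f x = 0 \<and> m_coord f x = 0)"
    unfolding double_cone_eq double_space_eq by blast
  also have "\<dots> \<longleftrightarrow> (\<forall>f. f \<notin> N \<longrightarrow> f \<notin> cone_support G {x})"
  proof -
    have "p_coord f x = 0 \<and> m_coord f x = 0 \<longleftrightarrow> f \<notin> cone_support G {x}" for f
      using assms(1) not_mem_cone_support_point[of f G x] cone_support_subset[of G "{x}"]
      unfolding causal_cone_def double_space_eq by (cases "f \<in> G") auto
    then show ?thesis by simp
  qed
  finally show ?thesis by blast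
qed

lemma causal_stratum_support:
  "y \<in> causal_stratum G x \<Longrightarrow> cone_support G {y} \<subseteq> cone_support G {x}"
  unfolding mem_causal_stratum_iff cone_support_def beta_plus_def beta_minus_def by auto

text \<open>
  Membership in \<^term>\<open>double_cone N\<close> may be dropped from the description of a face: a causal point
  whose coordinates vanish wherever those of \<open>x\<close> do is supported in \<open>N\<close> as soon as \<open>x\<close> is.
\<close>

lemma nonempty_faces_nested_cone_Int_causal_cone:
  assumes "N \<subseteq> G"
  shows "C face_of (double_cone N \<inter> causal_cone G) \<and> C \<noteq> {} \<longleftrightarrow>
    (\<exists>x\<in>causal_cone G. cone_support G {x} \<subseteq> N \<and> C = causal_stratum G x)"
proof -
  have stratum: "{y \<in> double_cone N \<inter> causal_cone G. \<forall>l\<in>causal_functionals G. l x = 0 \<longrightarrow> l y = 0} =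
      causal_stratum G x" if "cone_support G {x} \<subseteq> N" for x
    using causal_stratum_support[of _ G x] causal_point_mem_double_cone_iff[OF _ assms] that
    by (fastforce simp: causal_stratum_def)
  have "C face_of (double_cone N \<inter> causal_cone G) \<and> C \<noteq> {} \<longleftrightarrow>
    (\<exists>x\<in>double_cone N \<inter> causal_cone G.
       C = {y \<in> double_cone N \<inter> causal_cone G. \<forall>l\<in>causal_functionals G. l x = 0 \<longrightarrow> l y = 0})"
    by (rule nonempty_faces_of_inequality_system[OF subspace_double_space_m_top _ _
          nested_cone_Int_causal_cone[OF assms]])
      (simp_all add: causal_functionals_def linear_causal_functional[unfolded causal_functionals_def])
  also have "\<dots> \<longleftrightarrow> (\<exists>x\<in>causal_cone G. cone_support G {x} \<subseteq> N \<and> C = causal_stratum G x)"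
    using stratum causal_point_mem_double_cone_iff[OF _ assms] by (metis (no_types, lifting) Int_iff)
  finally show ?thesis .
qed

text \<open>
  Intersecting a face \<open>S\<close> of \<^term>\<open>double_cone N\<close> with the causal cone gives a face of
  \<^term>\<open>double_cone N \<inter> causal_cone G\<close>, so the faces of these larger intersections already
  are all the cones of the fan. Conversely, the stratum of \<open>x\<close> is a face of the intersection
  belonging to the support of \<open>x\<close> itself.
\<close>

lemma universe_fan_eq_strata:
  "universe_fan G = causal_stratum G ` {x \<in> causal_cone G. nested G (cone_support G {x})}"
proof (intro equalityI subsetI)
  fix C assume "C \<in> universe_fan G"
  then obtain S N where C: "C \<noteq> {}" "C face_of (S \<inter> causal_cone G)"
    and N: "nested G N" and S: "S face_of double_cone N"
    unfolding universe_fan_def double_fan_def nested_complex_def by blast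
  have NG: "N \<subseteq> G" using N nested_def by blast
  have "C face_of (double_cone N \<inter> causal_cone G)"
    using C(2) face_of_slice[OF S convex_causal_cone] by (rule face_of_trans)
  then obtain x where "x \<in> causal_cone G" "cone_support G {x} \<subseteq> N" "C = causal_stratum G x"
    using nonempty_faces_nested_cone_Int_causal_cone[OF NG] C(1) by blast
  then show "C \<in> causal_stratum G ` {x \<in> causal_cone G. nested G (cone_support G {x})}"
    using nested_subset[OF N] by blast
next
  fix C assume "C \<in> causal_stratum G ` {x \<in> causal_cone G. nested G (cone_support G {x})}"
  then obtain x where x: "x \<in> causal_cone G" "nested G (cone_support G {x})"
    and C: "C = causal_stratum G x" by blast
  let ?N = "cone_support G {x}"
  have "C face_of (double_cone ?N \<inter> causal_cone G) \<and> C \<noteq> {}"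
    using nonempty_faces_nested_cone_Int_causal_cone[OF cone_support_subset] x C by blast
  moreover have "double_cone ?N face_of double_cone ?N" "double_cone ?N \<noteq> {}"
    unfolding double_cone_def
    by (simp_all add: face_of_refl convex_convex_cone_hull convex_cone_hull_nonempty)
  ultimately show "C \<in> universe_fan G"
    using x(2) unfolding universe_fan_def double_fan_def nested_complex_def by blast
qed

text \<open>
  A functional that is nonzero somewhere on the stratum of \<open>x\<close> is nonzero at \<open>x\<close>.
\<close>

lemma betas_causal_stratum:
  assumes "x \<in> causal_cone G"
  shows "beta_plus G (causal_stratum G x) = beta_plus G {x}"
    and "beta_minus G (causal_stratum G x) = beta_minus G {x}"
    and "cone_support G (causal_stratum G x) = cone_support G {x}"
    and "beta_bullet G (causal_stratum G x) = beta_bullet G {x}"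
proof -
  have x: "x \<in> causal_stratum G x" using assms by (simp add: mem_causal_stratum_iff)
  show p: "beta_plus G (causal_stratum G x) = beta_plus G {x}"
    and m: "beta_minus G (causal_stratum G x) = beta_minus G {x}"
    using x unfolding beta_plus_def beta_minus_def by (auto simp: mem_causal_stratum_iff)
  then show s: "cone_support G (causal_stratum G x) = cone_support G {x}"
    unfolding cone_support_def by simp
  show "beta_bullet G (causal_stratum G x) = beta_bullet G {x}"
    using x cone_support_subset[of G "{x}"]
    unfolding beta_bullet_def s by (auto simp: mem_causal_stratum_iff)
qed

section \<open>Nested sets are forests\<close>

definition comparable_above :: "'a::order set \<Rightarrow> 'a \<Rightarrow> bool" where
  "comparable_above N g \<longleftrightarrow> (\<forall>f\<in>N. \<forall>h\<in>N. g < f \<longrightarrow> g < h \<longrightarrow> f \<le> h \<or> h \<le> f)"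

text \<open>
  Two incomparable elements of \<open>N\<close> have their join outside \<open>G\<close>, so they meet in \<open>bot\<close> and have no
  common lower bound in \<open>G\<close>. The element \<open>g\<close> ranges over \<open>G\<close> rather than \<open>N\<close>, because the causal
  cone imposes \<open>F\<^sub>g \<ge> 0\<close> for the elements outside \<open>N\<close> as well.
\<close>

lemma nested_comparable_above:
  assumes "nestable G" and "nested G N" and "g \<in> G"
  shows "comparable_above N g"
  unfolding comparable_above_def
proof (intro ballI impI)
  fix f h assume fh: "f \<in> N" "h \<in> N" "g < f" "g < h"
  show "f \<le> h \<or> h \<le> f"
  proof (rule ccontr)
    assume "\<not> (f \<le> h \<or> h \<le> f)"
    then have inc: "incomparable f h" "incomparable h f" "f \<noteq> h" by (auto simp: incomparable_def)
    have "{f, h} \<subseteq> N" "card {f, h} \<ge> 2" "pairwise incomparable {f, h}"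
      using fh inc by (auto simp: pairwise_def)
    then have "Sup_fin {f, h} \<notin> G" using assms(2) unfolding nested_def by blast
    then have "sup f h \<notin> G" by simp
    moreover have "f \<in> G" "h \<in> G" using fh assms(2) unfolding nested_def by auto
    ultimately have "inf f h = bot" using assms(1) inc(1) unfolding nestable_def by blast
    moreover have "g \<le> inf f h" using fh by (simp add: order_less_imp_le)
    moreover have "bot < g" using assms(1,3) unfolding nestable_def by auto
    ultimately show False by simp
  qed
qed

definition least_above :: "'a::order set \<Rightarrow> 'a \<Rightarrow> 'a \<Rightarrow> bool" where
  "least_above N g h \<longleftrightarrow> h \<in> N \<and> g < h \<and> (\<forall>f\<in>N. g < f \<longrightarrow> h \<le> f)"

lemma ex_least_above:
  assumes "finite N" and "comparable_above N g" and "f \<in> N" and "g < f"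
  shows "\<exists>h. least_above N g h"
proof -
  obtain h where "h \<in> {f \<in> N. g < f}" "\<forall>b \<in> {f \<in> N. g < f}. b \<le> h \<longrightarrow> h = b"
    using finite_has_minimal[of "{f \<in> N. g < f}"] assms by auto
  then have "least_above N g h"
    using assms(2) unfolding least_above_def comparable_above_def by (auto; metis)
  then show ?thesis by blast
qed

lemma covers_in_iff_least_above:
  assumes "comparable_above N g" and "g \<in> N"
  shows "covers_in N h g \<longleftrightarrow> least_above N g h"
  using assms unfolding covers_in_def least_above_def comparable_above_def
  by (metis leD order_le_imp_less_or_eq)

section \<open>The flow along a forest\<close>

text \<open>
  This is \<open>F\<^sub>g\<close> when the coordinates vanish outside \<open>N\<close> and \<open>m\<close> vanishes at the maximum, for \<open>g\<close>
  different from the maximum. There the value is \<open>- m\<close> instead of \<open>p - m\<close>: nothing passes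
  the maximum. With this value the conservation law holds for all elements alike, and it needs no
  bounds of the order, so that it can be used for subsets of a forest in an induction.
\<close>

definition transit :: "'a::order set \<Rightarrow> ('a \<Rightarrow> real) \<Rightarrow> ('a \<Rightarrow> real) \<Rightarrow> 'a \<Rightarrow> real" where
  "transit N p m g = (\<Sum>f\<in>{f\<in>N. g < f}. p f - m f) - m g"

text \<open>
  The elements of \<open>N\<close> above \<open>g\<close> are \<open>h\<close> and those above \<open>h\<close>. The element \<open>g\<close> may lie in \<open>N\<close>
  or not.
\<close>

lemma transit_conservation:
  assumes "finite N" and "least_above N g h"
  shows "transit N p m g + m g = transit N p m h + p h"
proof -
  have "{f \<in> N. g < f} = insert h {f \<in> N. h < f}"
    using assms(2) unfolding least_above_def by (auto simp: order_le_less)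
  then show ?thesis using assms(1) unfolding transit_def by simp
qed

lemma transit_no_above: "\<not> (\<exists>f\<in>N. g < f) \<Longrightarrow> transit N p m g = - m g"
proof -
  assume "\<not> (\<exists>f\<in>N. g < f)"
  then have "{f \<in> N. g < f} = {}" by blast
  then show ?thesis unfolding transit_def by (simp only: sum.empty)
qed

lemma flow_eq_transit:
  assumes "N \<subseteq> G" and "top \<in> G" and "m_coord top x = 0"
    and out: "\<And>f. f \<in> G - N \<Longrightarrow> p_coord f x = 0 \<and> m_coord f x = 0" and "g \<noteq> top"
  shows "flow G g x = transit N (\<lambda>f. p_coord f x) (\<lambda>f. m_coord f x) g"
proof -
  have "{f \<in> G. g < f} = insert top {f \<in> G. g < f \<and> f < top}"
    using assms(2,5) by (auto simp: top.not_eq_extremum)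
  then have "flow G g x = (\<Sum>f\<in>{f\<in>G. g < f}. p_coord f x - m_coord f x) - m_coord g x"
    using assms(3) unfolding flow_def by simp
  also have "(\<Sum>f\<in>{f\<in>G. g < f}. p_coord f x - m_coord f x) =
             (\<Sum>f\<in>{f\<in>N. g < f}. p_coord f x - m_coord f x)"
    using assms(1) out by (intro sum.mono_neutral_right) (simp, blast, force)
  finally show ?thesis unfolding transit_def .
qed

lemma flow_top: "flow G top x = p_coord top x - m_coord top x"
proof -
  have "{f \<in> G. top < f \<and> f < top} = {}" by auto
  then show ?thesis unfolding flow_def by (simp only: sum.empty)
qed

section \<open>Markings\<close>

text \<open>
  Combined, the covering conditions say that something leaves the upper element of a covering exactly
  when something arrives at the lower one.
\<close>

lemma marking_iff:
  "marking N P M B \<longleftrightarrow>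
     P \<subseteq> N \<and> M \<subseteq> N \<and> B \<subseteq> N \<and> N = P \<union> M \<and> max_elems N \<subseteq> P - (M \<union> B) \<and>
     (\<forall>f g. covers_in N f g \<longrightarrow> (f \<in> P \<union> B \<longleftrightarrow> g \<in> M \<union> B))"
  unfolding marking_def by blast

text \<open>
  The amounts \<open>transit f + p f\<close> and \<open>transit g + m g\<close> agree along a covering and are sums of
  nonnegative terms. At a maximal element the transit is \<open>- m\<close>, and nonnegativity of both forces
  them to vanish.
\<close>

lemma marking_of_transit:
  assumes "finite N" and forest: "\<And>g. g \<in> N \<Longrightarrow> comparable_above N g"
    and pm: "\<And>g. g \<in> N \<Longrightarrow> 0 \<le> p g \<and> 0 \<le> m g \<and> (p g \<noteq> 0 \<or> m g \<noteq> 0)"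
    and t: "\<And>g. g \<in> N \<Longrightarrow> 0 \<le> transit N p m g"
  shows "marking N {g\<in>N. p g \<noteq> 0} {g\<in>N. m g \<noteq> 0} {g\<in>N. transit N p m g \<noteq> 0}"
  unfolding marking_iff
proof (intro conjI allI impI)
  show "N = {g\<in>N. p g \<noteq> 0} \<union> {g\<in>N. m g \<noteq> 0}" using pm by blast
  show "max_elems N \<subseteq> {g\<in>N. p g \<noteq> 0} - ({g\<in>N. m g \<noteq> 0} \<union> {g\<in>N. transit N p m g \<noteq> 0})"
  proof
    fix g assume "g \<in> max_elems N"
    then have g: "g \<in> N" "\<not> (\<exists>f\<in>N. g < f)" unfolding max_elems_def by auto
    then have "m g = 0" "transit N p m g = 0"
      using t[OF g(1)] pm[OF g(1)] transit_no_above[OF g(2), of p m] by auto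
    then show "g \<in> {g\<in>N. p g \<noteq> 0} - ({g\<in>N. m g \<noteq> 0} \<union> {g\<in>N. transit N p m g \<noteq> 0})"
      using g pm[OF g(1)] by simp
  qed
next
  fix f g assume cov: "covers_in N f g"
  then have fg: "f \<in> N" "g \<in> N" unfolding covers_in_def by auto
  have "transit N p m g + m g = transit N p m f + p f"
    using cov covers_in_iff_least_above[OF forest[OF fg(2)] fg(2)]
      transit_conservation[OF assms(1)] by blast
  then show "f \<in> {g\<in>N. p g \<noteq> 0} \<union> {g\<in>N. transit N p m g \<noteq> 0} \<longleftrightarrow>
             g \<in> {g\<in>N. m g \<noteq> 0} \<union> {g\<in>N. transit N p m g \<noteq> 0}"
    using pm[OF fg(1)] pm[OF fg(2)] t[OF fg(1)] t[OF fg(2)] fg by auto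
qed auto

text \<open>
  The forest is built from the top by adding one minimal element \<open>g\<close> at a time, which affects no
  transit at the other elements. Only the value \<open>m g\<close> has to be chosen with care. It is part of the
  amount \<open>w\<close> that arrives from the element covering \<open>g\<close>: half of it if \<open>g\<close> carries both marks, all of
  it if nothing may pass, none of it if nothing may stop. The value \<open>p g\<close> influences only elements
  that are added later.
\<close>

lemma marking_realisable:
  assumes "finite N" and "\<And>g. g \<in> N \<Longrightarrow> comparable_above N g" and "marking N P M B"
  shows "\<exists>p m. (\<forall>f. 0 \<le> p f \<and> 0 \<le> m f \<and> (p f \<noteq> 0 \<longleftrightarrow> f \<in> P) \<and> (m f \<noteq> 0 \<longleftrightarrow> f \<in> M)) \<and>
               (\<forall>g\<in>N. 0 \<le> transit N p m g \<and> (transit N p m g \<noteq> 0 \<longleftrightarrow> g \<in> B))"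
  using assms
proof (induction N arbitrary: P M B rule: finite_psubset_induct)
  case (psubset N)
  show ?case
  proof (cases "N = {}")
    case True
    then show ?thesis
      using psubset.prems(2) by (intro exI[of _ "\<lambda>_. 0"]) (simp add: marking_def)
  next
    case False
    then obtain g where g: "g \<in> N" and gmin: "\<And>f. f \<in> N \<Longrightarrow> \<not> f < g"
      using finite_has_minimal[OF psubset.hyps(1)] by (metis less_le)
    define N' where "N' = N - {g}"
    have N': "N' \<subset> N" "finite N'" and gN': "g \<notin> N'" and gsub: "\<And>f. f \<in> N \<Longrightarrow> f \<noteq> g \<Longrightarrow> f \<in> N'"
      using g psubset.hyps(1) by (auto simp: N'_def)
    have forest': "comparable_above N' f" if "f \<in> N'" for f
      using psubset.prems(1)[of f] that unfolding comparable_above_def N'_def by blast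
    have mk: "P \<subseteq> N" "M \<subseteq> N" "B \<subseteq> N" "N = P \<union> M" "max_elems N \<subseteq> P - (M \<union> B)"
      "\<And>f h. covers_in N f h \<Longrightarrow> f \<in> P \<union> B \<longleftrightarrow> h \<in> M \<union> B"
      using psubset.prems(2) unfolding marking_iff by blast+
    have cov': "covers_in N f h" if "covers_in N' f h" for f h
      using that gmin unfolding covers_in_def N'_def by blast
    have max': "max_elems N' \<subseteq> max_elems N"
      using gmin unfolding max_elems_def N'_def by blast
    have "marking N' (P - {g}) (M - {g}) (B - {g})"
      unfolding marking_iff
    proof (intro conjI allI impI)
      show "max_elems N' \<subseteq> P - {g} - (M - {g} \<union> (B - {g}))"
        using max' mk(5) gN' by (auto simp: max_elems_def)
      fix f h assume "covers_in N' f h"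
      then show "f \<in> P - {g} \<union> (B - {g}) \<longleftrightarrow> h \<in> M - {g} \<union> (B - {g})"
        using mk(6)[OF cov'] gN' unfolding covers_in_def by (metis Diff_iff Un_iff singletonD)
    qed (use mk(1-4) in \<open>auto simp: N'_def\<close>)
    then obtain p' m' where
      pm': "\<And>f. 0 \<le> p' f \<and> 0 \<le> m' f \<and> (p' f \<noteq> 0 \<longleftrightarrow> f \<in> P - {g}) \<and> (m' f \<noteq> 0 \<longleftrightarrow> f \<in> M - {g})"
      and t': "\<And>f. f \<in> N' \<Longrightarrow>
        0 \<le> transit N' p' m' f \<and> (transit N' p' m' f \<noteq> 0 \<longleftrightarrow> f \<in> B - {g})"
      using psubset.IH[OF N'(1) forest'] by metis
    define p where "p = p'(g := if g \<in> P then 1 else 0)"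
    have transit_eq: "transit N p (m'(g := c)) f = transit N' p' m' f" if "f \<in> N'" for f c
    proof -
      have "{h \<in> N. f < h} = {h \<in> N'. f < h}" using gmin that unfolding N'_def by blast
      moreover have "(\<Sum>h\<in>{h \<in> N'. f < h}. p h - (m'(g := c)) h) = (\<Sum>h\<in>{h \<in> N'. f < h}. p' h - m' h)"
        by (rule sum.cong) (use gN' in \<open>auto simp: p_def\<close>)
      moreover have "(m'(g := c)) f = m' f" using that gN' by auto
      ultimately show ?thesis unfolding transit_def by simp
    qed
    have result: ?thesis if c: "0 \<le> c" "c \<noteq> 0 \<longleftrightarrow> g \<in> M"
      and tg: "0 \<le> transit N p (m'(g := c)) g" "transit N p (m'(g := c)) g \<noteq> 0 \<longleftrightarrow> g \<in> B" for c
    proof (rule exI[of _ p], rule exI[of _ "m'(g := c)"], rule conjI; intro allI ballI)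
      fix f
      show "0 \<le> p f \<and> 0 \<le> (m'(g := c)) f \<and> (p f \<noteq> 0 \<longleftrightarrow> f \<in> P) \<and> ((m'(g := c)) f \<noteq> 0 \<longleftrightarrow> f \<in> M)"
        using pm'[of f] c by (simp add: p_def)
    next
      fix f assume f: "f \<in> N"
      show "0 \<le> transit N p (m'(g := c)) f \<and> (transit N p (m'(g := c)) f \<noteq> 0 \<longleftrightarrow> f \<in> B)"
      proof (cases "f = g")
        case True
        then show ?thesis using tg by simp
      next
        case False
        then show ?thesis using t'[OF gsub[OF f False]] transit_eq[OF gsub[OF f False]] by simp
      qed
    qed
    show ?thesis
    proof (cases "\<exists>f\<in>N. g < f")
      case False
      then have "g \<in> max_elems N" using g unfolding max_elems_def by blast
      then have "g \<notin> M" "g \<notin> B" using mk(5) by auto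
      then show ?thesis using result[of 0] transit_no_above[OF False, of p "m'(g := 0)"] by simp
    next
      case True
      then obtain h where h: "least_above N g h"
        using ex_least_above[OF psubset.hyps(1) psubset.prems(1)[OF g]] by blast
      then have hN': "h \<in> N'" "h \<noteq> g" unfolding least_above_def N'_def by auto
      \<comment> \<open>the amount arriving at \<open>g\<close>, already determined by the flow on the rest of the forest\<close>
      define w where "w = transit N' p' m' h + p' h"
      have w0: "0 \<le> w" using t'[OF hN'(1)] pm'[of h] unfolding w_def by auto
      have "w \<noteq> 0 \<longleftrightarrow> h \<in> P \<union> B"
        using t'[OF hN'(1)] pm'[of h] hN'(2) unfolding w_def by auto
      also have "\<dots> \<longleftrightarrow> g \<in> M \<union> B"
        using mk(6) h covers_in_iff_least_above[OF psubset.prems(1)[OF g] g] by blast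
      finally have w: "w \<noteq> 0 \<longleftrightarrow> g \<in> M \<union> B" .
      have tg: "transit N p (m'(g := c)) g = w - c" for c
        using transit_conservation[OF psubset.hyps(1) h, of p "m'(g := c)"]
          transit_eq[OF hN'(1), of c] hN'(2) unfolding w_def p_def by simp
      consider "g \<in> M" "g \<in> B" | "g \<in> M" "g \<notin> B" | "g \<notin> M" by blast
      then show ?thesis
      proof cases
        case 1
        then have "0 < w" using w w0 by auto
        then show ?thesis using result[of "w / 2"] 1 tg by simp
      next
        case 2
        then have "w \<noteq> 0" using w by blast
        then show ?thesis using result[of w] 2 w0 tg by simp
      next
        case 3
        then have "w \<noteq> 0 \<longleftrightarrow> g \<in> B" using w by blast
        then show ?thesis using result[of 0] 3 w0 tg by simp
      qed
    qed
  qed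
qed

section \<open>The bijection\<close>

context
  fixes G :: "'a::{finite, bounded_lattice} set"
  assumes nestable: "nestable G"
begin

lemma top_mem: "top \<in> G"
  using nestable unfolding nestable_def by blast

lemma causal_flow_eq_transit:
  assumes "x \<in> causal_cone G" and "cone_support G {x} \<subseteq> N" and "N \<subseteq> G" and "g \<noteq> top"
  shows "flow G g x = transit N (\<lambda>f. p_coord f x) (\<lambda>f. m_coord f x) g"
proof (rule flow_eq_transit)
  show "m_coord top x = 0" using assms(1) unfolding causal_cone_def by blast
  show "p_coord f x = 0 \<and> m_coord f x = 0" if "f \<in> G - N" for f
    using that assms(2) not_mem_cone_support_point by blast
qed (use assms top_mem in auto)

lemma causal_transit_top:
  assumes "x \<in> causal_cone G"
  shows "transit N (\<lambda>f. p_coord f x) (\<lambda>f. m_coord f x) top = 0"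
  using assms transit_no_above[of N top "\<lambda>f. p_coord f x" "\<lambda>f. m_coord f x"]
  unfolding causal_cone_def by (auto simp: top.extremum_strict)

lemma causal_transit_nonneg:
  assumes "x \<in> causal_cone G" and "cone_support G {x} \<subseteq> N" and "N \<subseteq> G" and "g \<in> G"
  shows "0 \<le> transit N (\<lambda>f. p_coord f x) (\<lambda>f. m_coord f x) g"
proof (cases "g = top")
  case True
  then show ?thesis using causal_transit_top[OF assms(1)] by simp
next
  case False
  then show ?thesis
    using causal_flow_eq_transit[OF assms(1-3) False] assms(1,4) unfolding causal_cone_def by auto
qed

lemma marking_of_causal_point:
  assumes x: "x \<in> causal_cone G" and nested: "nested G (cone_support G {x})"
  shows "marking (cone_support G {x}) (beta_plus G {x}) (beta_minus G {x}) (beta_bullet G {x})"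
proof -
  let ?N = "cone_support G {x}"
  let ?p = "\<lambda>f. p_coord f x" and ?m = "\<lambda>f. m_coord f x"
  have NG: "?N \<subseteq> G" by (rule cone_support_subset)
  have top: "transit ?N ?p ?m top = 0" by (rule causal_transit_top[OF x])
  have flow: "transit ?N ?p ?m g = flow G g x" if "g \<noteq> top" for g
    using causal_flow_eq_transit[OF x order_refl NG that] by simp
  have "marking ?N {g\<in>?N. ?p g \<noteq> 0} {g\<in>?N. ?m g \<noteq> 0} {g\<in>?N. transit ?N ?p ?m g \<noteq> 0}"
  proof (rule marking_of_transit)
    show "comparable_above ?N g" if "g \<in> ?N" for g
      using nested_comparable_above[OF nestable nested] that NG by blast
    show "0 \<le> ?p g \<and> 0 \<le> ?m g \<and> (?p g \<noteq> 0 \<or> ?m g \<noteq> 0)" if "g \<in> ?N" for g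
      using that NG x not_mem_cone_support_point[of g G x] unfolding causal_cone_def by blast
    show "0 \<le> transit ?N ?p ?m g" if "g \<in> ?N" for g
      using causal_transit_nonneg[OF x order_refl NG] that NG by blast
  qed simp
  moreover have "{g\<in>?N. ?p g \<noteq> 0} = beta_plus G {x}" "{g\<in>?N. ?m g \<noteq> 0} = beta_minus G {x}"
    unfolding cone_support_def beta_plus_def beta_minus_def by auto
  moreover have "{g\<in>?N. transit ?N ?p ?m g \<noteq> 0} = beta_bullet G {x}"
    unfolding beta_bullet_def using top flow by auto metis
  ultimately show ?thesis by simp
qed

text \<open>
  The right-hand side mentions \<open>F\<^sub>g\<close> only for \<open>g\<close> in the support of \<open>x\<close> and below the maximum, and
  hence depends on \<open>x\<close> only through the four sets attached to it. If \<open>g \<in> G\<close> lies outside the support,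
  then \<open>F\<^sub>g = F\<^sub>h + p\<^sub>h\<close> for the least \<open>h\<close> of the support above \<open>g\<close> (with \<open>F\<^sub>h\<close> replaced by \<open>0\<close>
  if \<open>h\<close> is the maximum), or \<open>F\<^sub>g = 0\<close> if there is no such \<open>h\<close>. By nonnegativity \<open>F\<^sub>g\<close> vanishes at \<open>x\<close>
  only if both summands do, and these are controlled by the right-hand side.
\<close>

lemma causal_stratum_determined_by_betas:
  assumes x: "x \<in> causal_cone G" and nested: "nested G (cone_support G {x})"
  shows "causal_stratum G x =
    {y \<in> causal_cone G. beta_plus G {y} \<subseteq> beta_plus G {x} \<and> beta_minus G {y} \<subseteq> beta_minus G {x} \<and>
       (\<forall>g \<in> cone_support G {x} - {top} - beta_bullet G {x}. flow G g y = 0)}" (is "_ = ?R")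
proof (intro equalityI subsetI)
  fix y assume "y \<in> causal_stratum G x"
  then show "y \<in> ?R"
    using cone_support_subset[of G "{x}"]
    by (auto simp: mem_causal_stratum_iff beta_plus_def beta_minus_def beta_bullet_def)
next
  let ?N = "cone_support G {x}"
  fix y assume y: "y \<in> ?R"
  then have yc: "y \<in> causal_cone G" by blast
  have NG: "?N \<subseteq> G" by (rule cone_support_subset)
  have sub: "cone_support G {y} \<subseteq> ?N" using y unfolding cone_support_def by blast
  have p: "p_coord g y = 0" if "g \<in> G" "p_coord g x = 0" for g
    using that y unfolding beta_plus_def by auto
  have m: "m_coord g y = 0" if "g \<in> G" "m_coord g x = 0" for g
    using that y unfolding beta_minus_def by auto
  have flow_N: "flow G g y = 0" if "g \<in> ?N" "g \<noteq> top" "flow G g x = 0" for g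
    using that y unfolding beta_bullet_def by auto
  let ?tx = "transit ?N (\<lambda>f. p_coord f x) (\<lambda>f. m_coord f x)"
  let ?ty = "transit ?N (\<lambda>f. p_coord f y) (\<lambda>f. m_coord f y)"
  have flow_out: "flow G g y = 0" if gG: "g \<in> G" and gN: "g \<notin> ?N" and "g \<noteq> top" and "flow G g x = 0" for g
  proof -
    have tx: "?tx g = 0" and ty: "?ty g = flow G g y"
      using causal_flow_eq_transit[OF x order_refl NG] causal_flow_eq_transit[OF yc sub NG] that by auto
    have mx: "m_coord g x = 0" using gN not_mem_cone_support_point[OF gG] by blast
    have my: "m_coord g y = 0" by (rule m[OF gG mx])
    show ?thesis
    proof (cases "\<exists>f\<in>?N. g < f")
      case False
      then show ?thesis using ty my transit_no_above[OF False] by simp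
    next
      case True
      then obtain h where h: "least_above ?N g h"
        using ex_least_above[OF _ nested_comparable_above[OF nestable nested gG]] by auto
      then have hN: "h \<in> ?N" and hG: "h \<in> G" using NG unfolding least_above_def by auto
      have "?tx h + p_coord h x = 0"
        using transit_conservation[OF _ h, of "\<lambda>f. p_coord f x" "\<lambda>f. m_coord f x"] tx mx by simp
      moreover have "0 \<le> ?tx h" by (rule causal_transit_nonneg[OF x order_refl NG hG])
      moreover have "0 \<le> p_coord h x" using x hG unfolding causal_cone_def by blast
      ultimately have hx: "?tx h = 0" "p_coord h x = 0" by linarith+
      have "?ty h = 0"
      proof (cases "h = top")
        case True
        then show ?thesis using causal_transit_top[OF yc] by simp
      next
        case False
        then show ?thesis
          using hx(1) flow_N[OF hN False] causal_flow_eq_transit[OF x order_refl NG False]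
            causal_flow_eq_transit[OF yc sub NG False] by simp
      qed
      then show ?thesis
        using transit_conservation[OF _ h, of "\<lambda>f. p_coord f y" "\<lambda>f. m_coord f y"]
          ty my p[OF hG hx(2)] by simp
    qed
  qed
  have "flow G g y = 0" if "g \<in> G" "flow G g x = 0" for g
  proof (cases "g = top")
    case True
    have "m_coord top x = 0" "m_coord top y = 0" using x yc unfolding causal_cone_def by auto
    then show ?thesis using that p[of top] True by (simp add: flow_top)
  next
    case False
    then show ?thesis using that flow_N flow_out by blast
  qed
  then show "y \<in> causal_stratum G x"
    using yc p m by (simp add: mem_causal_stratum_iff)
qed

text \<open>
  The inequalities \<open>F\<^sub>g \<ge> 0\<close> with \<open>g\<close> outside \<open>N\<close> follow from those inside, again by conservation.
\<close>

lemma marking_realisable_in_causal_cone: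
  assumes nested: "nested G N" and mk: "marking N P M B"
  shows "\<exists>x\<in>causal_cone G. cone_support G {x} = N \<and> beta_plus G {x} = P \<and>
           beta_minus G {x} = M \<and> beta_bullet G {x} = B"
proof -
  have NG: "N \<subseteq> G" using nested unfolding nested_def by blast
  have sub: "P \<subseteq> N" "M \<subseteq> N" "B \<subseteq> N" "N = P \<union> M" "max_elems N \<inter> (M \<union> B) = {}"
    using mk unfolding marking_def by blast+
  have forest: "comparable_above N g" if "g \<in> G" for g
    by (rule nested_comparable_above[OF nestable nested that])
  obtain p m where
    pm: "\<And>f. 0 \<le> p f \<and> 0 \<le> m f \<and> (p f \<noteq> 0 \<longleftrightarrow> f \<in> P) \<and> (m f \<noteq> 0 \<longleftrightarrow> f \<in> M)"
    and t: "\<And>g. g \<in> N \<Longrightarrow> 0 \<le> transit N p m g \<and> (transit N p m g \<noteq> 0 \<longleftrightarrow> g \<in> B)"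
    using marking_realisable[OF finite forest mk] NG by blast
  define x :: "'a double" where "x = (\<chi> f. p f, \<chi> f. m f)"
  have coord [simp]: "p_coord f x = p f" "m_coord f x = m f" for f
    by (simp_all add: x_def p_coord_def m_coord_def)
  have "top \<notin> M" "top \<notin> B"
    using sub unfolding max_elems_def by (auto simp: top.extremum_strict)
  then have mtop: "m top = 0" using pm by blast
  have P: "beta_plus G {x} = P" and M: "beta_minus G {x} = M"
    unfolding beta_plus_def beta_minus_def using pm sub NG by auto
  then have supp: "cone_support G {x} = N" unfolding cone_support_def using sub by blast
  have flow: "flow G g x = transit N p m g" if "g \<noteq> top" for g
    using flow_eq_transit[OF NG top_mem _ _ that, of x] mtop pm sub by fastforce
  have transit_nonneg: "0 \<le> transit N p m g" if g: "g \<in> G" for g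
  proof (cases "g \<in> N")
    case True
    then show ?thesis using t by blast
  next
    case False
    then have m0: "m g = 0" using pm sub by blast
    show ?thesis
    proof (cases "\<exists>f\<in>N. g < f")
      case False
      then show ?thesis using m0 transit_no_above[OF False] by simp
    next
      case True
      then obtain h where h: "least_above N g h"
        using ex_least_above[OF finite forest[OF g]] by blast
      then have "0 \<le> transit N p m h" using t unfolding least_above_def by blast
      then show ?thesis using transit_conservation[OF finite h, of p m] m0 pm[of h] by simp
    qed
  qed
  have "0 \<le> flow G g x" if "g \<in> G" for g
    using that flow[of g] transit_nonneg flow_top[of G x] mtop pm[of top] by (cases "g = top") auto
  moreover have "x \<in> double_space G" unfolding double_space_eq using pm sub NG by auto
  ultimately have "x \<in> causal_cone G" unfolding causal_cone_def using mtop pm by simp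
  moreover have "beta_bullet G {x} = B"
  proof -
    have "flow G g x \<noteq> 0 \<longleftrightarrow> g \<in> B" if "g \<in> N" "g \<noteq> top" for g
      using flow[OF that(2)] t[OF that(1)] by simp
    then show ?thesis unfolding beta_bullet_def supp using sub(3) \<open>top \<notin> B\<close> by blast
  qed
  ultimately show ?thesis using P M supp by blast
qed

end

theorem theorem3p24:
  fixes G :: "'a::{finite, bounded_lattice} set"
  assumes "nestoid G"
  shows "bij_betw (\<lambda>C. (cone_support G C, beta_plus G C, beta_minus G C, beta_bullet G C))
           (universe_fan G) (marked_nested_sets G)"
proof -
  have nestable: "nestable G" using assms unfolding nestoid_def by blast
  let ?\<beta> = "\<lambda>C. (cone_support G C, beta_plus G C, beta_minus G C, beta_bullet G C)"
  let ?X = "{x \<in> causal_cone G. nested G (cone_support G {x})}"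
  have \<beta>: "?\<beta> (causal_stratum G x) = ?\<beta> {x}" if "x \<in> ?X" for x
    using that betas_causal_stratum[of x G] by simp
  have "inj_on ?\<beta> (universe_fan G)"
    unfolding universe_fan_eq_strata
  proof (rule inj_onI; elim imageE)
    fix C D x y
    assume eq: "?\<beta> C = ?\<beta> D" and C: "C = causal_stratum G x" "x \<in> ?X"
      and D: "D = causal_stratum G y" "y \<in> ?X"
    have "?\<beta> {x} = ?\<beta> {y}"
      using eq \<beta>[OF C(2)] \<beta>[OF D(2)] unfolding C(1) D(1) by argo
    then show "C = D"
      using C D causal_stratum_determined_by_betas[OF nestable] by simp
  qed
  moreover have "?\<beta> ` universe_fan G = marked_nested_sets G"
  proof (intro equalityI subsetI)
    fix q assume "q \<in> ?\<beta> ` universe_fan G"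
    then obtain x where x: "x \<in> ?X" and "q = ?\<beta> (causal_stratum G x)"
      unfolding universe_fan_eq_strata by blast
    then have "q = ?\<beta> {x}" using \<beta>[OF x] by argo
    then show "q \<in> marked_nested_sets G"
      using x marking_of_causal_point[OF nestable, of x]
      unfolding marked_nested_sets_def nested_complex_def by simp
  next
    fix q assume "q \<in> marked_nested_sets G"
    then obtain N P M B where q: "q = (N, P, M, B)" and "nested G N" "marking N P M B"
      unfolding marked_nested_sets_def nested_complex_def by blast
    then obtain x where x: "x \<in> ?X" and "?\<beta> {x} = q"
      using marking_realisable_in_causal_cone[OF nestable, of N P M B] by auto
    then have "q = ?\<beta> (causal_stratum G x)" using \<beta>[OF x] by argo
    then show "q \<in> ?\<beta> ` universe_fan G"
      unfolding universe_fan_eq_strata using x by (intro image_eqI[of q ?\<beta>]) auto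
  qed
  ultimately show ?thesis unfolding bij_betw_def by blast
qed

end
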